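(* The map $\Psi:\mathcal O_q\to\tilde{\mathcal A}_q^{\{\delta\}}$ such that $$\Psi(\mathsf A)=\mathcal W_0,\qquad \Psi(\mathsf A^* )=\mathcal W_1$$ is a surjective homomorphism (of unital associative $\mathbb K$-algebras).
   Context: Conventions. $\mathbb K$ is a field of characteristic different from $2$, $q\in\mathbb K$ is nonzero and not a root of unity, $\rho\in\mathbb K$ is nonzero (the same $\rho$ is used for $\mathcal O_q$ and $\mathcal A_q$), $\mathbb Z_+$ is the set of nonnegative integers, $[X,Y]=XY-YX$, $[X,Y]_q=qXY-q^{-1}YX$ and $[X,Y]_{q^{-1}}=q^{-1}XY-qYX$. All summation indices $i,j,l,m$ range in $\mathbb Z_+$; empty sums are zero. The $q$-Onsager algebra $\mathcal O_q$ is the unital associative $\mathbb K$-algebra with generators $\mathsf A,\mathsf A^*$ subject to the relations $$[\mathsf A,[\mathsf A,[\mathsf A,\mathsf A^*]_q]_{q^{-1}}]=\rho[\mathsf A,\mathsf A^*],\qquad [\mathsf A^*,[\mathsf A^*,[\mathsf A^*,\mathsf A]_q]_{q^{-1}}]=\rho[\mathsf A^*,\mathsf A].$$ The algebra $\mathcal A_q$. It is the unital associative $\mathbb K$-algebra with generators $\{\mathcal W_{-k},\mathcal W_{k+1},\mathcal G_{k+1},\tilde{\mathcal G}_{k+1}\mid k\in\mathbb Z_+\}$ and the following relations. Put $U=(qu^2+q^{-1}u^{-2})/(q+q^{-1})$, $V=(qv^2+q^{-1}v^{-2})/(q+q^{-1})$ with $u,v$ indeterminates, and $$\mathcal W_+(u)=\sum_{k\ge0}\mathcal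 W_{-k}U^{-k-1},\quad \mathcal W_-(u)=\sum_{k\ge0}\mathcal W_{k+1}U^{-k-1},\quad \mathcal G_+(u)=\sum_{k\ge0}\mathcal G_{k+1}U^{-k-1},\quad \mathcal G_-(u)=\sum_{k\ge0}\tilde{\mathcal G}_{k+1}U^{-k-1}$$ (and the same with $v,V$). The relations (identities of formal series in $U,V$; each holds for the upper and for the lower choice of signs, and fractions with denominator $U-V$ are understood after multiplying by $U-V$) are: (1) $[\mathcal W_\pm(u),\mathcal W_\pm(v)]=0$; (2) $[\mathcal W_+(u),\mathcal W_-(v)]+[\mathcal W_-(u),\mathcal W_+(v)]=0$; (3) $(U-V)[\mathcal W_\pm(u),\mathcal W_\mp(v)]=\frac{q-q^{-1}}{\rho(q+q^{-1})}\big(\mathcal G_\pm(u)\mathcal G_\mp(v)-\mathcal G_\pm(v)\mathcal G_\mp(u)\big)+\frac{1}{q+q^{-1}}\big(\mathcal G_\pm(u)-\mathcal G_\mp(u)+\mathcal G_\mp(v)-\mathcal G_\pm(v)\big)$; (4) $\mathcal W_\pm(u)\mathcal W_\pm(v)-\mathcal W_\mp(u)\mathcal W_\mp(v)+\frac{1}{\rho(q^2-q^{-2})}[\mathcal G_\pm(u),\mathcal G_\mp(v)]+\frac{1-UV}{U-V}\big(\mathcal W_\pm(u)\mathcal W_\mp(v)-\mathcal W_\pm(v)\mathcal W_\mp(u)\big)=0$; (5) $U[\mathcal G_\mp(v),\mathcal W_\pm(u)]_q-V[\mathcal G_\mp(u),\mathcal W_\pm(v)]_q-(q-q^{-1})\big(\mathcal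 W_\mp(u)\mathcal G_\mp(v)-\mathcal W_\mp(v)\mathcal G_\mp(u)\big)+\rho\big(U\mathcal W_\pm(u)-V\mathcal W_\pm(v)-\mathcal W_\mp(u)+\mathcal W_\mp(v)\big)=0$; (6) $U[\mathcal W_\mp(u),\mathcal G_\mp(v)]_q-V[\mathcal W_\mp(v),\mathcal G_\mp(u)]_q-(q-q^{-1})\big(\mathcal W_\pm(u)\mathcal G_\mp(v)-\mathcal W_\pm(v)\mathcal G_\mp(u)\big)+\rho\big(U\mathcal W_\mp(u)-V\mathcal W_\mp(v)-\mathcal W_\pm(u)+\mathcal W_\pm(v)\big)=0$; (7) $[\mathcal G_\epsilon(u),\mathcal W_\pm(v)]+[\mathcal W_\pm(u),\mathcal G_\epsilon(v)]=0$ for $\epsilon=\pm$; (8) $[\mathcal G_\pm(u),\mathcal G_\pm(v)]=0$; (9) $[\mathcal G_+(u),\mathcal G_-(v)]+[\mathcal G_-(u),\mathcal G_+(v)]=0$. The elements $\Delta_{k+1}$. For $k\in\mathbb Z_+$ let $\bar k=1$ and $[\frac k2]=\frac k2$ if $k$ is even, $\bar k=0$ and $[\frac k2]=\frac{k-1}2$ if $k$ is odd. Put $\mathbb G_{i+1}=\mathcal G_{i+1}+\tilde{\mathcal G}_{i+1}$, $\mathbb W_{ij}=(q-q^{-1})(\mathcal W_{-i}\mathcal W_{j+1}+\mathcal W_{i+1}\mathcal W_{-j})$, $\mathbb F_{ij}=(q-q^{-1})\big((q^2+q^{-2})(\mathcal W_{-i}\mathcal W_{-j}+\mathcal W_{i+1}\mathcal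 W_{j+1})+\frac1\rho(\mathcal G_{j+1}\tilde{\mathcal G}_{i+1}+\tilde{\mathcal G}_{j+1}\mathcal G_{i+1})\big)$, $c_{k+1}=-\frac{(q+q^{-1})^{k+1}(q^{k+1}+q^{-k-1})}{q^{2k+2}}$, $w^i_m=(-1)^m\frac{(m+i)!}{m!\,i!}(q+q^{-1})^{i+1}q^{-i-2m-1}$ for $m\ge0$, $w^i_{-1}=0$, $e^{(k)}_{ij}=-c_{k+1}^{-1}\sum_{m=0}^{[\frac k2]-\frac{i+j+\bar k}2}w^i_{[\frac k2]-\frac{i+j+\bar k}2-m}\,w^j_m\,q^{-2j-4m-2}$, $f^{(k)}_{ij}=c_{k+1}^{-1}\sum_{m=0}^{[\frac k2]-\frac{i+j+\bar k-1}2}w^i_{[\frac k2]-\frac{i+j+\bar k-1}2-m}\,(w^j_m+w^j_{m-1})\,q^{-2j-4m}$, $d^{(k)}_l=-c_{k+1}^{-1}w^{2l+1-\bar k}_{[\frac k2]-l}(1+q^{-2k-2})$, $$\Delta_{k+1}=\mathbb G_{k+1}+\sum_{l=0}^{[\frac k2]-1}d^{(k)}_l\mathbb G_{2(l+1)-\bar k}+\sum_{l=0}^{[\frac k2]}\sum_{i+j=2l+1-\bar k}f^{(k)}_{ij}\mathbb W_{ij}+\sum_{l=0}^{[\frac k2]-\bar k}\sum_{i+j=2l+\bar k}e^{(k)}_{ij}\mathbb F_{ij}.$$ The quotient. Let $\delta_{k+1}\in\mathbb K$ ($k\in\mathbb Z_+$) be fixed scalars. $\tilde{\mathcal A}_q^{\{\delta\}}$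 is the quotient of $\mathcal A_q$ by the ideal generated by the relations $\Delta_{k+1}=2\delta_{k+1}$ for all $k\in\mathbb Z_+$. Generators of $\mathcal A_q$ and their images in the quotient are denoted by the same symbols. *)

theory Defs
  imports
    "HOL-Library.Poly_Mapping"
    "HOL-Computational_Algebra.Formal_Laurent_Series"
    "HOL-Algebra.Module"
    "HOL-Algebra.QuotRing"
begin

section \<open>Unital associative algebras given by generators and relations\<close>

text \<open>
  Algebras that depend on parameters live on carrier sets, so a (not necessarily commutative)
  unital associative algebra over the field type \<open>'k\<close> is a HOL-Algebra record of type
  \<open>('k, 'a) module\<close>: the ring operations together with the scalar multiplication.
\<close>

definition alg_hom ::
    "('k, 'a, 'm) module_scheme \<Rightarrow> ('k, 'b, 'n) module_scheme \<Rightarrow> ('a \<Rightarrow> 'b) set" where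
  "alg_hom A B = {h \<in> ring_hom A B. \<forall>c. \<forall>x\<in>carrier A. h (c \<odot>\<^bsub>A\<^esub> x) = c \<odot>\<^bsub>B\<^esub> h x}"

definition quot_alg :: "('k, 'a) module \<Rightarrow> 'a set \<Rightarrow> ('k, 'a set) module" where
  "quot_alg A I =
    ring.extend (A Quot I) (module.fields (\<lambda>c X. \<Union>x\<in>X. I +>\<^bsub>A\<^esub> (c \<odot>\<^bsub>A\<^esub> x)))"

text \<open>
  Words under concatenation form the free monoid. It is written additively because the
  convolution product on \<open>\<Rightarrow>\<^sub>0\<close> expects its index monoid in additive notation.
\<close>

instantiation list :: (type) monoid_add
begin
definition zero_list :: "'a list" where "zero_list = []"
definition plus_list :: "'a list \<Rightarrow> 'a list \<Rightarrow> 'a list" where "plus_list xs ys = xs @ ys"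
instance by standard (simp_all add: zero_list_def plus_list_def)
end

text \<open>
  The type \<open>'g list \<Rightarrow>\<^sub>0 'k\<close> of finitely supported functions on words, with the convolution
  product, is the free unital associative \<open>'k\<close>-algebra on \<open>'g\<close>.
\<close>

definition scal :: "'k::field \<Rightarrow> 'g list \<Rightarrow>\<^sub>0 'k" where
  "scal c = Poly_Mapping.single [] c"

definition gen :: "'g \<Rightarrow> 'g list \<Rightarrow>\<^sub>0 'k::field" where
  "gen g = Poly_Mapping.single [g] 1"

definition free_algebra :: "('k::field, 'g list \<Rightarrow>\<^sub>0 'k) module" where
  "free_algebra =
    \<lparr>carrier = UNIV, mult = (*), one = 1, zero = 0, add = (+), smult = (\<lambda>c x. scal c * x)\<rparr>"

text \<open>Each element \<open>r\<close> of the set of relations stands for the relation \<open>r = 0\<close>;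
  \<^const>\<open>genideal\<close> generates two-sided ideals.\<close>

definition presented_algebra ::
    "('g list \<Rightarrow>\<^sub>0 'k::field) set \<Rightarrow> ('k, ('g list \<Rightarrow>\<^sub>0 'k) set) module" where
  "presented_algebra R = quot_alg free_algebra (Idl\<^bsub>free_algebra\<^esub> R)"

definition presented_class ::
    "('g list \<Rightarrow>\<^sub>0 'k::field) set \<Rightarrow> ('g list \<Rightarrow>\<^sub>0 'k) \<Rightarrow> ('g list \<Rightarrow>\<^sub>0 'k) set" where
  "presented_class R x = (Idl\<^bsub>free_algebra\<^esub> R) +>\<^bsub>free_algebra\<^esub> x"

text \<open>In the \<open>q\<close>-commutator, \<open>\<iota>\<close> embeds the scalars into the ring at hand;
  \<open>[X,Y]\<close> with subscript \<open>q\<^sup>-\<^sup>1\<close> is \<open>qcomm \<iota> (inverse q) X Y\<close>.\<close>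

definition comm :: "'a::ring_1 \<Rightarrow> 'a \<Rightarrow> 'a" where
  "comm X Y = X * Y - Y * X"

definition qcomm :: "('k::field \<Rightarrow> 'a::ring_1) \<Rightarrow> 'k \<Rightarrow> 'a \<Rightarrow> 'a \<Rightarrow> 'a" where
  "qcomm \<iota> q X Y = \<iota> q * X * Y - \<iota> (inverse q) * Y * X"


section \<open>The \<open>q\<close>-Onsager algebra\<close>

datatype oq_gen = GenA | GenAstar

definition oq_rels :: "'k::field \<Rightarrow> 'k \<Rightarrow> (oq_gen list \<Rightarrow>\<^sub>0 'k) set" where
  "oq_rels q \<rho> = (let A = gen GenA; As = gen GenAstar in
    {comm A (qcomm scal (inverse q) A (qcomm scal q A As)) - scal \<rho> * comm A As,
     comm As (qcomm scal (inverse q) As (qcomm scal q As A)) - scal \<rho> * comm As A})"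

definition Oq :: "'k::field \<Rightarrow> 'k \<Rightarrow> ('k, (oq_gen list \<Rightarrow>\<^sub>0 'k) set) module" where
  "Oq q \<rho> = presented_algebra (oq_rels q \<rho>)"

definition Oq_gen :: "'k::field \<Rightarrow> 'k \<Rightarrow> oq_gen \<Rightarrow> (oq_gen list \<Rightarrow>\<^sub>0 'k) set" where
  "Oq_gen q \<rho> g = presented_class (oq_rels q \<rho>) (gen g)"


section \<open>The algebra \<open>\<A>\<^sub>q\<close>\<close>

text \<open>
  \<open>WM k\<close>, \<open>WP k\<close>, \<open>GG k\<close>, \<open>GT k\<close> stand for the generators
  \<open>\<W>\<close> with index \<open>-k\<close>, \<open>\<W>\<close> with index \<open>k+1\<close>, \<open>\<G>\<close> with index \<open>k+1\<close> and
  \<open>\<G>\<close> tilde with index \<open>k+1\<close>.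
\<close>

datatype aq_gen = WM nat | WP nat | GG nat | GT nat

text \<open>
  The relations are identities between formal series in \<open>U\<^sup>-\<^sup>1\<close> and \<open>V\<^sup>-\<^sup>1\<close> multiplied by
  polynomials in \<open>U\<close>, \<open>V\<close>. They are stated in the ring \<open>'a fls fls\<close> of Laurent series over the
  (noncommutative) free algebra \<open>'a\<close>: the inner Laurent variable is \<open>U\<^sup>-\<^sup>1\<close>, the outer one is
  \<open>V\<^sup>-\<^sup>1\<close>. Both variables are central.
\<close>

definition U_var :: "'a::ring_1 fls fls" where
  "U_var = fls_const fls_X_inv"

definition V_var :: "'a::ring_1 fls fls" where
  "V_var = fls_X_inv"

definition series_u :: "(nat \<Rightarrow> 'a::ring_1) \<Rightarrow> 'a fls fls" where
  "series_u x =
    fls_const (fps_to_fls (Abs_fps (\<lambda>n. case n of 0 \<Rightarrow> 0 | Suc k \<Rightarrow> x k)))"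

definition series_v :: "(nat \<Rightarrow> 'a::ring_1) \<Rightarrow> 'a fls fls" where
  "series_v x =
    fps_to_fls (Abs_fps (\<lambda>n. case n of 0 \<Rightarrow> 0 | Suc k \<Rightarrow> fls_const (x k)))"

definition scal_ser :: "'k::field \<Rightarrow> ('g list \<Rightarrow>\<^sub>0 'k) fls fls" where
  "scal_ser c = fls_const (fls_const (scal c))"

text \<open>Signs are Booleans, with \<open>True\<close> for plus, so that \<open>\<plusminus>\<close> and \<open>\<mp>\<close> become \<open>s\<close> and \<open>\<not> s\<close>.\<close>

definition Wu :: "bool \<Rightarrow> (aq_gen list \<Rightarrow>\<^sub>0 'k::field) fls fls" where
  "Wu s = series_u (\<lambda>k. gen (if s then WM k else WP k))"

definition Wv :: "bool \<Rightarrow> (aq_gen list \<Rightarrow>\<^sub>0 'k::field) fls fls" where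
  "Wv s = series_v (\<lambda>k. gen (if s then WM k else WP k))"

definition Gu :: "bool \<Rightarrow> (aq_gen list \<Rightarrow>\<^sub>0 'k::field) fls fls" where
  "Gu s = series_u (\<lambda>k. gen (if s then GG k else GT k))"

definition Gv :: "bool \<Rightarrow> (aq_gen list \<Rightarrow>\<^sub>0 'k::field) fls fls" where
  "Gv s = series_v (\<lambda>k. gen (if s then GG k else GT k))"

text \<open>The set contains the differences of the two sides of the defining identities. The fourth
  one has been multiplied by \<open>U - V\<close>.\<close>

definition aq_series_rels :: "'k::field \<Rightarrow> 'k \<Rightarrow> (aq_gen list \<Rightarrow>\<^sub>0 'k) fls fls set" where
  "aq_series_rels q \<rho> = (let U = U_var; V = V_var; \<iota> = scal_ser; p = q + inverse q in
    (\<Union>s\<in>UNIV. {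
      comm (Wu s) (Wv s),
      (U - V) * comm (Wu s) (Wv (\<not> s))
        - (\<iota> ((q - inverse q) / (\<rho> * p)) * (Gu s * Gv (\<not> s) - Gv s * Gu (\<not> s))
           + \<iota> (1 / p) * (Gu s - Gu (\<not> s) + Gv (\<not> s) - Gv s)),
      (U - V) * (Wu s * Wv s - Wu (\<not> s) * Wv (\<not> s)
           + \<iota> (1 / (\<rho> * (q^2 - inverse q ^ 2))) * comm (Gu s) (Gv (\<not> s)))
        + (1 - U * V) * (Wu s * Wv (\<not> s) - Wv s * Wu (\<not> s)),
      U * qcomm \<iota> q (Gv (\<not> s)) (Wu s) - V * qcomm \<iota> q (Gu (\<not> s)) (Wv s)
        - \<iota> (q - inverse q) * (Wu (\<not> s) * Gv (\<not> s) - Wv (\<not> s) * Gu (\<not> s))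
        + \<iota> \<rho> * (U * Wu s - V * Wv s - Wu (\<not> s) + Wv (\<not> s)),
      U * qcomm \<iota> q (Wu (\<not> s)) (Gv (\<not> s)) - V * qcomm \<iota> q (Wv (\<not> s)) (Gu (\<not> s))
        - \<iota> (q - inverse q) * (Wu s * Gv (\<not> s) - Wv s * Gu (\<not> s))
        + \<iota> \<rho> * (U * Wu (\<not> s) - V * Wv (\<not> s) - Wu s + Wv s),
      comm (Gu True) (Wv s) + comm (Wu s) (Gv True),
      comm (Gu False) (Wv s) + comm (Wu s) (Gv False),
      comm (Gu s) (Gv s)
    }) \<union> {
      comm (Wu True) (Wv False) + comm (Wu False) (Wv True),
      comm (Gu True) (Gv False) + comm (Gu False) (Gv True)
    })"

definition aq_rels :: "'k::field \<Rightarrow> 'k \<Rightarrow> (aq_gen list \<Rightarrow>\<^sub>0 'k) set" where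
  "aq_rels q \<rho> = {fls_nth (fls_nth S b) a | S a b. S \<in> aq_series_rels q \<rho>}"

definition Aq :: "'k::field \<Rightarrow> 'k \<Rightarrow> ('k, (aq_gen list \<Rightarrow>\<^sub>0 'k) set) module" where
  "Aq q \<rho> = presented_algebra (aq_rels q \<rho>)"


section \<open>The elements \<open>\<Delta>\<^sub>k\<^sub>+\<^sub>1\<close> and the quotient\<close>

definition kbar :: "nat \<Rightarrow> nat" where
  "kbar k = (if even k then 1 else 0)"

text \<open>For both parities \<open>[k/2]\<close> is \<open>k div 2\<close>. An index \<open>k\<close> of \<open>c_coeff\<close> and \<open>Delta\<close> stands for
  the subscript \<open>k + 1\<close>.\<close>

definition c_coeff :: "'k::field \<Rightarrow> nat \<Rightarrow> 'k" where
  "c_coeff q k =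
    - ((q + inverse q) ^ (k + 1) * (q ^ (k + 1) + inverse q ^ (k + 1)) / q ^ (2 * k + 2))"

text \<open>The quotient of factorials is an integer and is written as a binomial coefficient before
  it is mapped to the field, whose characteristic may divide the factorials.\<close>

definition w_coeff :: "'k::field \<Rightarrow> nat \<Rightarrow> int \<Rightarrow> 'k" where
  "w_coeff q i m = (if m < 0 then 0
     else (- 1) ^ nat m * of_nat ((nat m + i) choose i) * (q + inverse q) ^ (i + 1)
            * q powi (- int i - 2 * m - 1))"

text \<open>Below, \<open>i + j + kbar k\<close> resp. \<open>i + j + kbar k - 1\<close> is always even.\<close>

definition e_coeff :: "'k::field \<Rightarrow> nat \<Rightarrow> nat \<Rightarrow> nat \<Rightarrow> 'k" where
  "e_coeff q k i j =
    (let M = int (k div 2) - (int i + int j + int (kbar k)) div 2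
     in - inverse (c_coeff q k) *
        (\<Sum>m\<in>{0..M}. w_coeff q i (M - m) * w_coeff q j m * q powi (- 2 * int j - 4 * m - 2)))"

definition f_coeff :: "'k::field \<Rightarrow> nat \<Rightarrow> nat \<Rightarrow> nat \<Rightarrow> 'k" where
  "f_coeff q k i j =
    (let M = int (k div 2) - (int i + int j + int (kbar k) - 1) div 2
     in inverse (c_coeff q k) *
        (\<Sum>m\<in>{0..M}. w_coeff q i (M - m) * (w_coeff q j m + w_coeff q j (m - 1))
            * q powi (- 2 * int j - 4 * m)))"

definition d_coeff :: "'k::field \<Rightarrow> nat \<Rightarrow> nat \<Rightarrow> 'k" where
  "d_coeff q k l =
    - inverse (c_coeff q k) * w_coeff q (2 * l + 1 - kbar k) (int (k div 2) - int l)
      * (1 + q powi (- 2 * int k - 2))"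

text \<open>\<open>bbG i\<close> has subscript \<open>i + 1\<close>.\<close>

definition bbG :: "nat \<Rightarrow> aq_gen list \<Rightarrow>\<^sub>0 'k::field" where
  "bbG i = gen (GG i) + gen (GT i)"

definition bbW :: "'k::field \<Rightarrow> nat \<Rightarrow> nat \<Rightarrow> aq_gen list \<Rightarrow>\<^sub>0 'k" where
  "bbW q i j =
    scal (q - inverse q) * (gen (WM i) * gen (WP j) + gen (WP i) * gen (WM j))"

definition bbF :: "'k::field \<Rightarrow> 'k \<Rightarrow> nat \<Rightarrow> nat \<Rightarrow> aq_gen list \<Rightarrow>\<^sub>0 'k" where
  "bbF q \<rho> i j =
    scal (q - inverse q) *
      (scal (q^2 + inverse q ^ 2) * (gen (WM i) * gen (WM j) + gen (WP i) * gen (WP j))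
       + scal (1 / \<rho>) * (gen (GG j) * gen (GT i) + gen (GT j) * gen (GG i)))"

text \<open>This is the defining expression of \<open>\<Delta>\<close> read in the free algebra; the element of
  \<open>\<A>\<^sub>q\<close> is its class. The ranges of \<open>l\<close> are \<open>0 \<le> l \<le> [k/2] - 1\<close>, \<open>0 \<le> l \<le> [k/2]\<close> and
  \<open>0 \<le> l \<le> [k/2] - kbar k\<close>; the first and the last one are written with a strict upper bound so
  that these ranges are empty when the stated bound is negative. The final \<open>- 1\<close> in the argument of \<open>bbG\<close>
  is the index shift of \<open>bbG\<close>.\<close>

definition Delta_free :: "'k::field \<Rightarrow> 'k \<Rightarrow> nat \<Rightarrow> aq_gen list \<Rightarrow>\<^sub>0 'k" where
  "Delta_free q \<rho> k =
    bbG k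
    + (\<Sum>l<k div 2. scal (d_coeff q k l) * bbG (2 * (l + 1) - kbar k - 1))
    + (\<Sum>l\<le>k div 2. \<Sum>(i, j)\<in>{(i, j). i + j = 2 * l + 1 - kbar k}.
          scal (f_coeff q k i j) * bbW q i j)
    + (\<Sum>l<k div 2 + 1 - kbar k. \<Sum>(i, j)\<in>{(i, j). i + j = 2 * l + kbar k}.
          scal (e_coeff q k i j) * bbF q \<rho> i j)"

definition Delta :: "'k::field \<Rightarrow> 'k \<Rightarrow> nat \<Rightarrow> (aq_gen list \<Rightarrow>\<^sub>0 'k) set" where
  "Delta q \<rho> k = presented_class (aq_rels q \<rho>) (Delta_free q \<rho> k)"

text \<open>In the quotient, \<open>\<delta> k\<close> is the scalar with subscript \<open>k + 1\<close>.\<close>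

definition Aq_delta_ideal ::
    "'k::field \<Rightarrow> 'k \<Rightarrow> (nat \<Rightarrow> 'k) \<Rightarrow> (aq_gen list \<Rightarrow>\<^sub>0 'k) set set" where
  "Aq_delta_ideal q \<rho> \<delta> =
    Idl\<^bsub>Aq q \<rho>\<^esub> (range (\<lambda>k.
      Delta q \<rho> k \<ominus>\<^bsub>Aq q \<rho>\<^esub> ((2 * \<delta> k) \<odot>\<^bsub>Aq q \<rho>\<^esub> \<one>\<^bsub>Aq q \<rho>\<^esub>)))"

definition Aq_delta ::
    "'k::field \<Rightarrow> 'k \<Rightarrow> (nat \<Rightarrow> 'k) \<Rightarrow> ('k, (aq_gen list \<Rightarrow>\<^sub>0 'k) set set) module" where
  "Aq_delta q \<rho> \<delta> = quot_alg (Aq q \<rho>) (Aq_delta_ideal q \<rho> \<delta>)"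

definition Aq_delta_gen ::
    "'k::field \<Rightarrow> 'k \<Rightarrow> (nat \<Rightarrow> 'k) \<Rightarrow> aq_gen \<Rightarrow> (aq_gen list \<Rightarrow>\<^sub>0 'k) set set" where
  "Aq_delta_gen q \<rho> \<delta> g =
    Aq_delta_ideal q \<rho> \<delta> +>\<^bsub>Aq q \<rho>\<^esub> presented_class (aq_rels q \<rho>) (gen g)"

end

theory Submission
  imports Defs
begin

text \<open>
  The relation \<open>\<Delta>\<^sub>1 = 2\<delta>\<^sub>1\<close> fixes \<open>\<G>\<^sub>1 + \<G>\<^sub>1\<close> tilde, while \<open>[\<W>\<^sub>0, \<W>\<^sub>1]\<close> fixes their difference; hence
  \<open>\<G>\<^sub>1 = [\<W>\<^sub>1, \<W>\<^sub>0]\<^sub>q + \<delta>\<^sub>1\<close>. Substituting this into the relations that express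
  \<open>\<W>\<close> with index \<open>-1\<close> as \<open>\<W>\<^sub>1 + \<rho>\<^sup>-\<^sup>1 [\<W>\<^sub>0, \<G>\<^sub>1]\<^sub>q\<close>, and \<open>\<W>\<^sub>2\<close> as \<open>\<W>\<^sub>0 + \<rho>\<^sup>-\<^sup>1 [\<G>\<^sub>1, \<W>\<^sub>1]\<^sub>q\<close>, turns
  \<open>[\<W>\<^sub>0, \<W>\<^sub>-\<^sub>1] = 0\<close> and \<open>[\<W>\<^sub>1, \<W>\<^sub>2] = 0\<close> into the defining relations of \<open>\<O>\<^sub>q\<close>.
  The same relations with higher index give surjectivity by induction: \<open>[\<W>\<^sub>0, \<W>\<^sub>k\<^sub>+\<^sub>1]\<close> and
  \<open>\<Delta>\<close> with index \<open>k+1\<close> determine the two \<open>\<G>\<close> with index \<open>k+1\<close>, since all other terms of \<open>\<Delta>\<close>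
  involve only earlier generators, and these determine the next two \<open>\<W>\<close>. The values of the coefficients of
  \<open>\<Delta>\<close> play a role only for \<open>k = 0\<close>.
\<close>

text \<open>Meant for \<open>quot_alg\<close>, whose record extends the factor ring by a scalar
  multiplication: the two records have different types, so the ring structure is carried over field
  by field.\<close>

lemma ring_eqI:
  assumes "ring R" "carrier S = carrier R" "mult S = mult R" "one S = one R"
    "zero S = zero R" "add S = add R"
  shows "ring S"
proof -
  interpret ring R by fact
  show ?thesis
  proof (rule ringI)
    show "abelian_group S"
      by (rule abelian_groupI) (auto simp: assms a_ac intro: l_neg)
    show "Group.monoid S"
      by (rule monoidI) (auto simp: assms m_assoc)
  qed (auto simp: assms l_distr r_distr)
qed

section \<open>Quotients of algebras on carrier sets\<close>

text \<open>Scalars act as left multiplication by \<open>c \<odot> \<one>\<close>, so every ideal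
  absorbs them and the action descends to quotients.\<close>

locale scalar_ring = ring A for A :: "('k::field, 'a) module" (structure) +
  assumes smult_closed [simp, intro]: "x \<in> carrier A \<Longrightarrow> c \<odot> x \<in> carrier A"
    and smult_eq: "x \<in> carrier A \<Longrightarrow> c \<odot> x = (c \<odot> \<one>) \<otimes> x"

lemma scalar_ring_free_algebra: "scalar_ring free_algebra"
proof (intro scalar_ring.intro ringI)
  show "abelian_group free_algebra"
    by (rule abelian_groupI) (auto simp: free_algebra_def add_ac intro: exI[of _ "- _"])
  show "Group.monoid free_algebra"
    by (rule monoidI) (auto simp: free_algebra_def mult.assoc)
  show "scalar_ring_axioms free_algebra"
    by unfold_locales (auto simp: free_algebra_def)
qed (auto simp: free_algebra_def algebra_simps)

lemma carrier_free_algebra [simp]: "carrier free_algebra = UNIV"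
  by (simp add: free_algebra_def)

lemma quot_alg_simps:
  "carrier (quot_alg A I) = carrier (A Quot I)"
  "mult (quot_alg A I) = mult (A Quot I)"
  "one (quot_alg A I) = one (A Quot I)"
  "zero (quot_alg A I) = zero (A Quot I)"
  "add (quot_alg A I) = add (A Quot I)"
  "smult (quot_alg A I) = (\<lambda>c X. \<Union>x\<in>X. I +>\<^bsub>A\<^esub> (c \<odot>\<^bsub>A\<^esub> x))"
  by (simp_all add: quot_alg_def ring.extend_def module.fields_def)

lemma carrier_quot_alg: "carrier (quot_alg A I) = (\<lambda>x. I +>\<^bsub>A\<^esub> x) ` carrier A"
  by (auto simp: quot_alg_simps FactRing_simps)

context scalar_ring
begin

text \<open>The product in \<open>quot_alg\<close> is a union over all representatives
  \<open>i \<oplus> x\<close>. Since \<open>c \<odot> (i \<oplus> x)\<close> differs from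
  \<open>c \<odot> x\<close> by \<open>(c \<odot> \<one>) \<otimes> i\<close>, which lies in
  \<open>I\<close>, all members of the union coincide.\<close>

lemma smult_coset:
  assumes "ideal I A" "x \<in> carrier A"
  shows "c \<odot>\<^bsub>quot_alg A I\<^esub> (I +> x) = I +> (c \<odot> x)"
proof -
  interpret ideal I A by fact
  have "I +> (c \<odot> y) = I +> (c \<odot> x)" if y: "y \<in> I +> x" for y
  proof -
    obtain i where i: "i \<in> I" "y = i \<oplus> x"
      using y by (auto simp: a_r_coset_def')
    have "c \<odot> y = (c \<odot> \<one>) \<otimes> i \<oplus> c \<odot> x"
      using i assms a_Hcarr by (simp add: smult_eq[of x] smult_eq[of "i \<oplus> x"] r_distr)
    then have "c \<odot> y \<in> I +> (c \<odot> x)"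
      using i I_l_closed by (auto simp: a_r_coset_def')
    then show ?thesis
      using a_repr_independence a_subgroup assms(2) by (metis smult_closed)
  qed
  then have "(\<Union>y\<in>I +> x. I +> (c \<odot> y)) = (\<Union>y\<in>I +> x. I +> (c \<odot> x))"
    by simp
  also have "\<dots> = I +> (c \<odot> x)"
    using a_rcos_self assms(2) by blast
  finally show ?thesis
    by (simp add: quot_alg_simps)
qed

lemma coset_alg_hom:
  assumes "ideal I A"
  shows "(\<lambda>x. I +> x) \<in> alg_hom A (quot_alg A I)"
  using ideal.rcos_ring_hom[OF assms] smult_coset[OF assms]
  by (auto simp: alg_hom_def ring_hom_def quot_alg_simps)

lemma scalar_ring_quot_alg:
  assumes "ideal I A"
  shows "scalar_ring (quot_alg A I)"
proof -
  interpret ideal I A by fact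
  have "x \<in> carrier A \<Longrightarrow> y \<in> carrier A \<Longrightarrow>
      (I +> x) \<otimes>\<^bsub>quot_alg A I\<^esub> (I +> y) = I +> (x \<otimes> y)" for x y
    by (simp add: quot_alg_simps FactRing_simps rcoset_mult_add)
  moreover have "\<one>\<^bsub>quot_alg A I\<^esub> = I +> \<one>"
    by (simp add: quot_alg_simps FactRing_simps)
  ultimately have "scalar_ring_axioms (quot_alg A I)"
    using smult_coset[OF assms]
    by (intro scalar_ring_axioms.intro) (auto simp: carrier_quot_alg simp flip: smult_eq)
  then show ?thesis
    using ring_eqI[OF quotient_is_ring quot_alg_simps(1-5)] by (simp add: scalar_ring_def)
qed

lemma coset_eq_zero:
  assumes "ideal I A" "x \<in> I"
  shows "I +> x = \<zero>\<^bsub>quot_alg A I\<^esub>"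
proof -
  interpret ideal I A by fact
  show ?thesis
    using a_rcos_const[OF assms(2)] by (simp add: quot_alg_simps FactRing_simps)
qed

text \<open>Universal property of the quotient: \<open>h\<close> kills \<open>I\<close>, hence is
  constant on cosets and can be evaluated at a chosen representative.\<close>

lemma alg_hom_quot_alg:
  assumes I: "ideal I A" and B: "scalar_ring B" and h: "h \<in> alg_hom A B"
    and zero: "\<And>x. x \<in> I \<Longrightarrow> h x = \<zero>\<^bsub>B\<^esub>"
  obtains \<Psi> where "\<Psi> \<in> alg_hom (quot_alg A I) B"
    and "\<And>x. x \<in> carrier A \<Longrightarrow> \<Psi> (I +> x) = h x"
proof -
  interpret ideal I A by fact
  interpret B: scalar_ring B by fact
  define \<Psi> where "\<Psi> X = h (SOME x. x \<in> X)" for X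
  have eq: "\<Psi> (I +> x) = h x" if x: "x \<in> carrier A" for x
  proof -
    define y where "y = (SOME y. y \<in> I +> x)"
    have "y \<in> I +> x"
      unfolding y_def using a_rcos_self[OF x] by (rule someI)
    then obtain i where "i \<in> I" and y: "y = i \<oplus> x"
      by (auto simp: a_r_coset_def')
    moreover have "h (i \<oplus> x) = h i \<oplus>\<^bsub>B\<^esub> h x"
      using h x a_Hcarr[OF \<open>i \<in> I\<close>] ring_hom_add[of h A B i x] unfolding alg_hom_def by blast
    moreover have "h x \<in> carrier B"
      using h x ring_hom_closed[of h A B x] unfolding alg_hom_def by blast
    ultimately show ?thesis
      using zero unfolding \<Psi>_def y_def[symmetric] by simp
  qed
  have "\<Psi> \<in> ring_hom (quot_alg A I) B"
  proof (rule ring_hom_memI)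
    note hs = ring_hom_closed[of h A B] ring_hom_mult[of h A B] ring_hom_add[of h A B]
      ring_hom_one[of h A B]
    have h': "h \<in> ring_hom A B"
      using h by (simp add: alg_hom_def)
    show "\<Psi> X \<in> carrier B" if "X \<in> carrier (quot_alg A I)" for X
      using that hs(1)[OF h'] by (auto simp: carrier_quot_alg eq)
    show "\<Psi> (X \<otimes>\<^bsub>quot_alg A I\<^esub> Y) = \<Psi> X \<otimes>\<^bsub>B\<^esub> \<Psi> Y"
      "\<Psi> (X \<oplus>\<^bsub>quot_alg A I\<^esub> Y) = \<Psi> X \<oplus>\<^bsub>B\<^esub> \<Psi> Y"
      if XY: "X \<in> carrier (quot_alg A I)" "Y \<in> carrier (quot_alg A I)" for X Y
    proof -
      obtain x y where xy: "x \<in> carrier A" "y \<in> carrier A" "X = I +> x" "Y = I +> y"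
        using XY unfolding carrier_quot_alg by blast
      have "X \<otimes>\<^bsub>quot_alg A I\<^esub> Y = I +> (x \<otimes> y)"
        using xy by (simp add: quot_alg_simps FactRing_simps rcoset_mult_add)
      then show "\<Psi> (X \<otimes>\<^bsub>quot_alg A I\<^esub> Y) = \<Psi> X \<otimes>\<^bsub>B\<^esub> \<Psi> Y"
        using xy hs(2)[OF h' xy(1,2)] by (simp add: eq)
      have "X \<oplus>\<^bsub>quot_alg A I\<^esub> Y = I +> (x \<oplus> y)"
        using xy by (simp add: quot_alg_simps FactRing_simps a_rcos_sum)
      then show "\<Psi> (X \<oplus>\<^bsub>quot_alg A I\<^esub> Y) = \<Psi> X \<oplus>\<^bsub>B\<^esub> \<Psi> Y"
        using xy hs(3)[OF h' xy(1,2)] by (simp add: eq)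
    qed
    show "\<Psi> \<one>\<^bsub>quot_alg A I\<^esub> = \<one>\<^bsub>B\<^esub>"
      using hs(4)[OF h'] by (simp add: quot_alg_simps FactRing_simps eq)
  qed
  then have "\<Psi> \<in> alg_hom (quot_alg A I) B"
    using h by (auto simp: alg_hom_def carrier_quot_alg smult_coset[OF I] eq)
  then show thesis
    using that eq by blast
qed

text \<open>The kernel of \<open>h\<close> is an ideal containing \<open>R\<close>, and
  \<open>Idl R\<close> is the smallest such ideal.\<close>

lemma alg_hom_genideal:
  assumes "R \<subseteq> carrier A" "scalar_ring B" "h \<in> alg_hom A B"
    and "\<And>r. r \<in> R \<Longrightarrow> h r = \<zero>\<^bsub>B\<^esub>" and "x \<in> Idl R"
  shows "h x = \<zero>\<^bsub>B\<^esub>"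
proof -
  interpret B: scalar_ring B by fact
  interpret ring_hom_ring A B h
    using assms(3) by (intro ring_hom_ringI2 ring_axioms B.ring_axioms) (simp add: alg_hom_def)
  have "Idl R \<subseteq> a_kernel A B h"
  proof (rule genideal_minimal[OF kernel_is_ideal])
    show "R \<subseteq> a_kernel A B h"
      using assms(1,4) unfolding a_kernel_def' by blast
  qed
  then show ?thesis
    using assms(5) unfolding a_kernel_def' by blast
qed

end

lemma alg_hom_comp:
  assumes "f \<in> alg_hom A B" "g \<in> alg_hom B C"
  shows "(\<lambda>x. g (f x)) \<in> alg_hom A C"
proof -
  have "(\<lambda>x. g (f x)) \<in> ring_hom A C"
    using ring_hom_trans[of f A B g C] assms by (simp add: alg_hom_def comp_def)
  moreover have "f x \<in> carrier B" if "x \<in> carrier A" for x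
    using ring_hom_closed[of f A B x] assms(1) that by (simp add: alg_hom_def)
  ultimately show ?thesis
    using assms by (simp add: alg_hom_def)
qed

section \<open>Presented algebras and their universal property\<close>

lemma presented_class_alg_hom:
  "presented_class R \<in> alg_hom free_algebra (presented_algebra R)"
  and scalar_ring_presented_algebra: "scalar_ring (presented_algebra R)"
  and presented_class_rel: "r \<in> R \<Longrightarrow> presented_class R r = \<zero>\<^bsub>presented_algebra R\<^esub>"
  and carrier_presented_algebra: "carrier (presented_algebra R) = range (presented_class R)"
proof -
  interpret F: scalar_ring free_algebra
    by (rule scalar_ring_free_algebra)
  have I: "ideal (Idl\<^bsub>free_algebra\<^esub> R) free_algebra"
    by (simp add: F.genideal_ideal)
  show "presented_class R \<in> alg_hom free_algebra (presented_algebra R)"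
    using F.coset_alg_hom[OF I] unfolding presented_algebra_def presented_class_def by simp
  show "scalar_ring (presented_algebra R)"
    unfolding presented_algebra_def by (rule F.scalar_ring_quot_alg[OF I])
  show "presented_class R r = \<zero>\<^bsub>presented_algebra R\<^esub>" if "r \<in> R"
    unfolding presented_algebra_def presented_class_def
    using that F.genideal_self[of R] F.coset_eq_zero[OF I] by (simp add: subset_iff)
  show "carrier (presented_algebra R) = range (presented_class R)"
    unfolding presented_algebra_def presented_class_def by (simp add: carrier_quot_alg)
qed

lemma alg_hom_presented_algebra:
  assumes "scalar_ring B" "h \<in> alg_hom free_algebra B" "\<And>r. r \<in> R \<Longrightarrow> h r = \<zero>\<^bsub>B\<^esub>"
  obtains \<Psi> where "\<Psi> \<in> alg_hom (presented_algebra R) B"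
    and "\<And>x. \<Psi> (presented_class R x) = h x"
proof -
  interpret F: scalar_ring free_algebra
    by (rule scalar_ring_free_algebra)
  have "h x = \<zero>\<^bsub>B\<^esub>" if "x \<in> Idl\<^bsub>free_algebra\<^esub> R" for x
    using F.alg_hom_genideal[OF _ assms that] by simp
  moreover have "ideal (Idl\<^bsub>free_algebra\<^esub> R) free_algebra"
    by (simp add: F.genideal_ideal)
  ultimately obtain \<Psi> where
    "\<Psi> \<in> alg_hom (quot_alg free_algebra (Idl\<^bsub>free_algebra\<^esub> R)) B"
    "\<And>x. x \<in> carrier free_algebra \<Longrightarrow> \<Psi> (Idl\<^bsub>free_algebra\<^esub> R +>\<^bsub>free_algebra\<^esub> x) = h x"
    using F.alg_hom_quot_alg[OF _ assms(1,2)] by blast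
  then show thesis
    by (intro that[of \<Psi>]) (simp_all add: presented_algebra_def presented_class_def)
qed

section \<open>The free algebra and substitution\<close>

lemma update_eq_add:
  assumes "a \<notin> Poly_Mapping.keys f"
  shows "Poly_Mapping.update a b f = f + Poly_Mapping.single a b"
  using assms by (intro poly_mapping_eqI) (auto simp: lookup_update lookup_add lookup_single
      when_def in_keys_iff)

lemma scal_simps:
  "scal 0 = 0" "scal 1 = 1" "scal (a + b) = scal a + scal b" "scal (- a) = - scal a"
  "scal (a - b) = scal a - scal b" "scal (a * b) = scal a * scal b"
  by (simp_all add: scal_def single_add single_uminus single_diff mult_single
      flip: zero_list_def)

text \<open>One monomial is added at a time; a scalar sits on the empty word, which commutes with
  every word under concatenation.\<close>

lemma scal_commute: "x * scal c = scal c * x"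
  for x :: "'g list \<Rightarrow>\<^sub>0 'k::field"
proof (induction x rule: update_induct)
  case const
  then show ?case by simp
next
  case (update f a b)
  have "Poly_Mapping.update a b f = f + Poly_Mapping.single a b"
    using update by (simp add: update_eq_add)
  moreover have "Poly_Mapping.single a b * scal c = scal c * Poly_Mapping.single a b"
    by (simp add: scal_def mult_single mult.commute plus_list_def)
  ultimately show ?case
    using update by (simp add: algebra_simps)
qed

lemma scal_mult_left: "scal c * (scal d * x) = scal (c * d) * x"
  by (simp add: scal_simps mult.assoc)

lemma scal_2: "scal 2 * x = x + x"
  by (simp only: scal_simps distrib_right mult_1_left flip: one_add_one)

lemma gen_scal: "gen g * scal c = scal c * gen g" "gen g * (scal c * x) = scal c * (gen g * x)"
  by (metis scal_commute, metis scal_commute mult.assoc)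

text \<open>Elements are finite sums of monomials, and a monomial is built by prefixing generators
  to a scalar on the empty word.\<close>

lemma free_algebra_induct [case_names scal gen add mult]:
  fixes x :: "'g list \<Rightarrow>\<^sub>0 'k::field"
  assumes scal: "\<And>c. P (scal c)" and gen: "\<And>g. P (gen g)"
    and add: "\<And>x y. P x \<Longrightarrow> P y \<Longrightarrow> P (x + y)"
    and mult: "\<And>x y. P x \<Longrightarrow> P y \<Longrightarrow> P (x * y)"
  shows "P x"
proof -
  have word: "P (Poly_Mapping.single w c)" for w and c :: 'k
  proof (induction w)
    case Nil
    then show ?case using scal[of c] by (simp add: scal_def)
  next
    case (Cons g w)
    then have "P (gen g * Poly_Mapping.single w c)"
      by (intro mult gen)
    then show ?case by (simp add: gen_def mult_single plus_list_def)
  qed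
  show ?thesis
  proof (induction x rule: update_induct)
    case const
    then show ?case using scal[of 0] by (simp add: scal_simps)
  next
    case (update f a b)
    have "Poly_Mapping.update a b f = f + Poly_Mapping.single a b"
      using update by (simp add: update_eq_add)
    then show ?case
      using add[OF update.IH word[of a b]] by simp
  qed
qed

section \<open>Homomorphisms of free algebras extending a map on generators\<close>

definition subst :: "('g \<Rightarrow> 'h list \<Rightarrow>\<^sub>0 'k) \<Rightarrow> ('g list \<Rightarrow>\<^sub>0 'k::field) \<Rightarrow> 'h list \<Rightarrow>\<^sub>0 'k" where
  "subst f x = (\<Sum>w\<in>Poly_Mapping.keys x. scal (Poly_Mapping.lookup x w) * prod_list (map f w))"

text \<open>Additional words have coefficient 0, so several elements can be summed over one common
  support.\<close>

lemma subst_superset: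
  assumes "finite S" "Poly_Mapping.keys x \<subseteq> S"
  shows "subst f x = (\<Sum>w\<in>S. scal (Poly_Mapping.lookup x w) * prod_list (map f w))"
  unfolding subst_def using assms
  by (intro sum.mono_neutral_left) (auto simp: in_keys_iff scal_simps)

lemma subst_single: "subst f (Poly_Mapping.single w c) = scal c * prod_list (map f w)"
  by (subst subst_superset[of "{w}"]) auto

lemma subst_add: "subst f (x + y) = subst f x + subst f y"
proof -
  let ?S = "Poly_Mapping.keys x \<union> Poly_Mapping.keys y"
  have "Poly_Mapping.keys (x + y) \<subseteq> ?S" by (rule Poly_Mapping.keys_add)
  then show ?thesis
    by (simp add: subst_superset[of ?S] lookup_add scal_simps distrib_right sum.distrib)
qed

lemma subst_zero: "subst f 0 = 0"
  by (simp add: subst_def)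

lemma subst_diff: "subst f (x - y) = subst f x - subst f y"
  using subst_add[of f "x - y" y] by (simp add: algebra_simps)

lemma subst_scal: "subst f (scal c) = scal c"
  by (simp add: scal_def subst_single)

lemma subst_gen: "subst f (gen g) = f g"
  by (simp add: gen_def subst_single scal_simps)

text \<open>By additivity it suffices to treat monomials, first in \<open>y\<close>, then in
  \<open>x\<close>. There the words concatenate, and centrality of scalars brings both coefficients
  to the front.\<close>

lemma subst_mult: "subst f (x * y) = subst f x * subst f y"
proof -
  have single: "subst f (Poly_Mapping.single v a * Poly_Mapping.single w b)
      = subst f (Poly_Mapping.single v a) * subst f (Poly_Mapping.single w b)" for v w a b
    by (simp add: mult_single subst_single plus_list_def scal_simps mult.assoc)
      (metis mult.assoc scal_commute)
  have left: "subst f (Poly_Mapping.single v a * y)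
      = subst f (Poly_Mapping.single v a) * subst f y" for v a
    by (induction y rule: update_induct)
      (auto simp: update_eq_add distrib_left subst_add single subst_zero)
  show ?thesis
    by (induction x rule: update_induct) (auto simp: update_eq_add distrib_right subst_add left subst_zero)
qed

lemma subst_alg_hom: "subst f \<in> alg_hom free_algebra free_algebra"
  using subst_scal[of f 1]
  by (auto simp: alg_hom_def ring_hom_def free_algebra_def subst_mult subst_add subst_scal scal_simps)

text \<open>Phrased over the type class, so that calculating modulo the relations is ordinary
  arithmetic in the free algebra instead of arithmetic with cosets.\<close>

locale two_sided_ideal =
  fixes K :: "'a::ring_1 set"
  assumes zero: "0 \<in> K"
    and add: "x \<in> K \<Longrightarrow> y \<in> K \<Longrightarrow> x + y \<in> K"
    and lmult: "x \<in> K \<Longrightarrow> z * x \<in> K"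
    and rmult: "x \<in> K \<Longrightarrow> x * z \<in> K"
begin

lemma diff: "x \<in> K \<Longrightarrow> y \<in> K \<Longrightarrow> x - y \<in> K"
  using add[of x "- 1 * y"] lmult[of y "- 1"] by simp

lemma comm_closed: "x \<in> K \<Longrightarrow> comm z x \<in> K"
  unfolding comm_def by (intro diff lmult rmult)

lemma qcomm_closed:
  "x \<in> K \<Longrightarrow> qcomm \<iota> c z x \<in> K" "x \<in> K \<Longrightarrow> qcomm \<iota> c x z \<in> K"
  unfolding qcomm_def by (intro diff lmult rmult; assumption)+

end

lemma two_sided_ideal_kernel:
  fixes h :: "('g list \<Rightarrow>\<^sub>0 'k::field) \<Rightarrow> 'b"
  assumes "scalar_ring B" "h \<in> alg_hom free_algebra B"
  shows "two_sided_ideal {x. h x = \<zero>\<^bsub>B\<^esub>}"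
proof -
  interpret F: scalar_ring "free_algebra :: ('k, 'g list \<Rightarrow>\<^sub>0 'k) module"
    by (rule scalar_ring_free_algebra)
  interpret B: scalar_ring B by fact
  interpret ring_hom_ring free_algebra B h
    using assms(2) by (intro ring_hom_ringI2 F.ring_axioms B.ring_axioms) (simp add: alg_hom_def)
  have simps: "h (x + y) = h x \<oplus>\<^bsub>B\<^esub> h y" "h (x * y) = h x \<otimes>\<^bsub>B\<^esub> h y"
    "h 0 = \<zero>\<^bsub>B\<^esub>" "h x \<in> carrier B" for x y
    using hom_add[of x y] hom_mult[of x y] hom_zero hom_closed[of x]
    by (simp_all add: free_algebra_def)
  show ?thesis
    by unfold_locales (simp_all add: simps)
qed

lemma alg_hom_free_algebra_eq_iff:
  fixes h :: "('g list \<Rightarrow>\<^sub>0 'k::field) \<Rightarrow> 'b"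
  assumes "scalar_ring B" "h \<in> alg_hom free_algebra B"
  shows "h x = h y \<longleftrightarrow> h (x - y) = \<zero>\<^bsub>B\<^esub>"
proof -
  interpret B: scalar_ring B by fact
  have add: "h (x + y) = h x \<oplus>\<^bsub>B\<^esub> h y" and closed: "h x \<in> carrier B" for x y
    using assms(2) ring_hom_add[of h free_algebra B x y] ring_hom_closed[of h free_algebra B x]
    by (simp_all add: alg_hom_def free_algebra_def)
  have "h x = h (x - y) \<oplus>\<^bsub>B\<^esub> h y"
    using add[of "x - y" y] by simp
  then show ?thesis
    using closed[of "x - y"] closed[of y] by (metis B.l_zero B.zero_closed B.add.right_cancel)
qed

lemma alg_hom_free_algebra_eqI:
  fixes h h' :: "('g list \<Rightarrow>\<^sub>0 'k::field) \<Rightarrow> 'b"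
  assumes h: "h \<in> alg_hom free_algebra B" and h': "h' \<in> alg_hom free_algebra B"
    and "\<And>g. h (gen g) = h' (gen g)"
  shows "h x = h' x"
proof -
  have hom: "f (scal c) = c \<odot>\<^bsub>B\<^esub> \<one>\<^bsub>B\<^esub>" "f (x + y) = f x \<oplus>\<^bsub>B\<^esub> f y" "f (x * y) = f x \<otimes>\<^bsub>B\<^esub> f y"
    if "f \<in> alg_hom free_algebra B" for f :: "('g list \<Rightarrow>\<^sub>0 'k) \<Rightarrow> 'b" and c x y
  proof -
    have ring: "f \<in> ring_hom free_algebra B"
      and smult: "f (c \<odot>\<^bsub>free_algebra\<^esub> x) = c \<odot>\<^bsub>B\<^esub> f x" for c x
      using that by (simp_all add: alg_hom_def)
    show "f (scal c) = c \<odot>\<^bsub>B\<^esub> \<one>\<^bsub>B\<^esub>"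
      using smult[of c 1] ring_hom_one[OF ring] by (simp add: free_algebra_def)
    show "f (x + y) = f x \<oplus>\<^bsub>B\<^esub> f y" "f (x * y) = f x \<otimes>\<^bsub>B\<^esub> f y"
      using ring_hom_add[OF ring, of x y] ring_hom_mult[OF ring, of x y]
      by (simp_all add: free_algebra_def)
  qed
  show ?thesis
    by (induction x rule: free_algebra_induct) (simp_all add: hom[OF h] hom[OF h'] assms(3))
qed

section \<open>Coefficients of the defining relations\<close>

text \<open>The coefficient at the power \<open>- a\<close> of \<open>U\<close> and
  \<open>- b\<close> of \<open>V\<close>, the Laurent variables being the inverses of
  \<open>U\<close> and \<open>V\<close>.\<close>

definition coef :: "'a::ring_1 fls fls \<Rightarrow> int \<Rightarrow> int \<Rightarrow> 'a" where
  "coef S a b = fls_nth (fls_nth S b) a"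

text \<open>The generating series start at exponent 1, so \<open>x k\<close> sits at
  \<open>k + 1\<close>; all other integer exponents get 0.\<close>

definition ser :: "(nat \<Rightarrow> 'a::ring_1) \<Rightarrow> int \<Rightarrow> 'a" where
  "ser x n = (if n \<le> 0 then 0 else x (nat (n - 1)))"

lemma ser_nth:
  "fls_nth (fps_to_fls (Abs_fps (\<lambda>n. case n of 0 \<Rightarrow> 0 | Suc k \<Rightarrow> x k))) n = ser x n"
proof (cases "n \<le> 0")
  case True
  then show ?thesis by (cases "n = 0") (auto simp: ser_def)
next
  case False
  then have "nat n = Suc (nat (n - 1))" by simp
  then show ?thesis using False by (simp add: ser_def)
qed

lemma ser_const: "ser (\<lambda>k. fls_const (x k)) n = fls_const (ser x n)"
  by (simp add: ser_def)

text \<open>\<open>U_var\<close> and \<open>V_var\<close> invert the Laurent variables, so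
  multiplying by them reads the coefficient one place later. Products of a series in
  \<open>U\<close> and one in \<open>V\<close> keep their noncommutative order.\<close>

lemma coef_simps:
  "coef (S + T) a b = coef S a b + coef T a b"
  "coef (S - T) a b = coef S a b - coef T a b"
  "coef (U_var * S) a b = coef S (a + 1) b"
  "coef (V_var * S) a b = coef S a (b + 1)"
  "coef (series_u x) a b = (if b = 0 then ser x a else 0)"
  "coef (series_v y) a b = (if a = 0 then ser y b else 0)"
  "coef (series_u x * series_v y) a b = ser x a * ser y b"
  "coef (series_v y * series_u x) a b = ser y b * ser x a"
  by (simp_all add: coef_def U_var_def V_var_def series_u_def series_v_def ser_nth
      ser_const fls_X_inv_times_conv_shift del: fps_to_fls_nth)

lemma coef_U_minus_V:
  "coef ((U_var - V_var) * S) a b = coef S (a + 1) b - coef S a (b + 1)"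
  by (simp add: left_diff_distrib coef_simps)

lemma coef_scal_ser: "coef (scal_ser c * S) a b = scal c * coef S a b"
  by (simp add: coef_def scal_ser_def)

lemma series_rel_in_aq_rels: "S \<in> aq_series_rels q \<rho> \<Longrightarrow> coef S a b \<in> aq_rels q \<rho>"
  unfolding aq_rels_def coef_def by blast

section \<open>Individual relations as coefficients of the series identities\<close>

lemma aq_rels_WM_WM: "comm (gen (WM i)) (gen (WM j)) \<in> aq_rels q \<rho>"
  and aq_rels_WP_WP: "comm (gen (WP i)) (gen (WP j)) \<in> aq_rels q \<rho>"
proof -
  have "comm (Wu s) (Wv s) \<in> aq_series_rels q \<rho>" for s
    unfolding aq_series_rels_def Let_def
    by (rule UnI1, rule UN_I[where a=s]) (simp_all only: UNIV_I insert_iff simp_thms)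
  from series_rel_in_aq_rels[OF this[of True], of "int i + 1" "int j + 1"]
    series_rel_in_aq_rels[OF this[of False], of "int i + 1" "int j + 1"]
  show "comm (gen (WM i)) (gen (WM j)) \<in> aq_rels q \<rho>"
    "comm (gen (WP i)) (gen (WP j)) \<in> aq_rels q \<rho>"
    by (simp_all add: comm_def Wu_def Wv_def coef_simps ser_def)
qed

text \<open>Taken at the power 0 of \<open>U\<close> and \<open>- (k + 1)\<close> of
  \<open>V\<close>. A series in \<open>U\<close> has no constant term, which removes all products of
  two \<open>\<G>\<close> and the part multiplied by \<open>V\<close>; the factor \<open>U\<close>
  brings in the first coefficient, \<open>\<W>\<^sub>0\<close>.\<close>

lemma aq_rels_W0_WP:
  "comm (gen (WM 0)) (gen (WP k)) - scal (1 / (q + inverse q)) * (gen (GT k) - gen (GG k))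
    \<in> aq_rels q \<rho>"
proof -
  have "(U_var - V_var) * comm (Wu s) (Wv (\<not> s))
      - (scal_ser ((q - inverse q) / (\<rho> * (q + inverse q))) * (Gu s * Gv (\<not> s) - Gv s * Gu (\<not> s))
        + scal_ser (1 / (q + inverse q)) * (Gu s - Gu (\<not> s) + Gv (\<not> s) - Gv s))
      \<in> aq_series_rels q \<rho>" for s
    unfolding aq_series_rels_def Let_def
    by (rule UnI1, rule UN_I[where a=s]) (simp_all only: UNIV_I insert_iff simp_thms)
  from series_rel_in_aq_rels[OF this[of True], of 0 "int k + 1"]
  show ?thesis
    by (simp add: comm_def Wu_def Wv_def Gu_def Gv_def coef_simps coef_scal_ser coef_U_minus_V ser_def)
qed

text \<open>The same coefficient position, with lower signs: of the quadratic terms only the bracket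
  multiplied by \<open>U\<close> survives, and the factor \<open>V\<close> raises the index of the
  linear term to \<open>k + 1\<close>.\<close>

lemma aq_rels_GG_W1:
  "qcomm scal q (gen (GG k)) (gen (WP 0)) - scal \<rho> * (gen (WP (k + 1)) - gen (WM k)) \<in> aq_rels q \<rho>"
proof -
  have "U_var * qcomm scal_ser q (Gv (\<not> s)) (Wu s) - V_var * qcomm scal_ser q (Gu (\<not> s)) (Wv s)
        - scal_ser (q - inverse q) * (Wu (\<not> s) * Gv (\<not> s) - Wv (\<not> s) * Gu (\<not> s))
        + scal_ser \<rho> * (U_var * Wu s - V_var * Wv s - Wu (\<not> s) + Wv (\<not> s))
      \<in> aq_series_rels q \<rho>" for s
    unfolding aq_series_rels_def Let_def
    by (rule UnI1, rule UN_I[where a=s]) (simp_all only: UNIV_I insert_iff simp_thms)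
  from series_rel_in_aq_rels[OF this[of False], of 0 "int k + 1"]
  show ?thesis
    by (simp add: qcomm_def Wu_def Wv_def Gu_def Gv_def coef_simps coef_scal_ser ser_def
        mult.assoc nat_add_distrib algebra_simps)
qed

lemma aq_rels_W0_GG:
  "qcomm scal q (gen (WM 0)) (gen (GG k)) - scal \<rho> * (gen (WM (k + 1)) - gen (WP k)) \<in> aq_rels q \<rho>"
proof -
  have "U_var * qcomm scal_ser q (Wu (\<not> s)) (Gv (\<not> s)) - V_var * qcomm scal_ser q (Wv (\<not> s)) (Gu (\<not> s))
        - scal_ser (q - inverse q) * (Wu s * Gv (\<not> s) - Wv s * Gu (\<not> s))
        + scal_ser \<rho> * (U_var * Wu (\<not> s) - V_var * Wv (\<not> s) - Wu s + Wv s)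
      \<in> aq_series_rels q \<rho>" for s
    unfolding aq_series_rels_def Let_def
    by (rule UnI1, rule UN_I[where a=s]) (simp_all only: UNIV_I insert_iff simp_thms)
  from series_rel_in_aq_rels[OF this[of False], of 0 "int k + 1"]
  show ?thesis
    by (simp add: qcomm_def Wu_def Wv_def Gu_def Gv_def coef_simps coef_scal_ser ser_def
        mult.assoc nat_add_distrib algebra_simps)
qed

text \<open>For \<open>k = 0\<close> the sums with \<open>d_coeff\<close> and \<open>e_coeff\<close>
  are empty and the one with \<open>f_coeff\<close> has the single index pair
  \<open>(0, 0)\<close>.\<close>

lemma Delta_free_0:
  assumes "q \<noteq> 0" "q + inverse q \<noteq> 0"
  shows "Delta_free q \<rho> 0 = gen (GG 0) + gen (GT 0)
    - scal (q - inverse q) * (gen (WM 0) * gen (WP 0) + gen (WP 0) * gen (WM 0))"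
proof -
  have "{(i, j). i + j = (0::nat)} = {(0, 0)}"
    by auto
  moreover have "f_coeff q 0 0 0 = - 1"
  proof -
    \<comment> \<open>Both coefficients are expressed through \<open>x\<close>:
      \<open>f_coeff\<close> is \<open>x * x\<close> divided by \<open>- (x * x)\<close>.\<close>
    define x where "x = (q + inverse q) * inverse q"
    have "x \<noteq> 0"
      using assms by (simp add: x_def)
    moreover have "c_coeff q 0 = - (x * x)" "w_coeff q 0 0 = x" "w_coeff q 0 (- 1) = 0"
      by (simp_all add: c_coeff_def w_coeff_def x_def power2_eq_square power_int_minus
          divide_inverse ac_simps)
    ultimately show ?thesis
      by (simp add: f_coeff_def kbar_def field_simps)
  qed
  ultimately show ?thesis
    by (simp add: Delta_free_def kbar_def bbG_def bbW_def scal_simps)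
qed

section \<open>Calculation modulo the relations\<close>

text \<open>\<open>K\<close> will be the kernel of the projection of the free algebra onto the
  quotient.\<close>

locale Aq_delta_kernel = two_sided_ideal K
  for K :: "(aq_gen list \<Rightarrow>\<^sub>0 'k::field) set" +
  fixes q \<rho> :: 'k and \<delta> :: "nat \<Rightarrow> 'k"
  assumes nz: "(2::'k) \<noteq> 0" "q \<noteq> 0" "q + inverse q \<noteq> 0" "\<rho> \<noteq> 0"
    and aq_rel: "r \<in> aq_rels q \<rho> \<Longrightarrow> r \<in> K"
    and Delta_rel: "Delta_free q \<rho> k - scal (2 * \<delta> k) \<in> K"
begin

section \<open>The defining relations of \<open>\<O>\<^sub>q\<close> hold modulo
  \<open>K\<close>\<close>

lemma W0_WP:
  "scal (q + inverse q) * comm (gen (WM 0)) (gen (WP k)) - (gen (GT k) - gen (GG k)) \<in> K"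
proof -
  have "scal (q + inverse q) * (comm (gen (WM 0)) (gen (WP k))
      - scal (1 / (q + inverse q)) * (gen (GT k) - gen (GG k))) \<in> K"
    by (intro lmult aq_rel aq_rels_W0_WP)
  then show ?thesis
    using nz by (simp add: right_diff_distrib[of "scal _"] scal_mult_left scal_simps(2))
qed

lemma GG_0: "gen (GG 0) - scal (\<delta> 0) - qcomm scal q (gen (WP 0)) (gen (WM 0)) \<in> K"
proof -
  let ?r = "gen (GG 0) - scal (\<delta> 0) - qcomm scal q (gen (WP 0)) (gen (WM 0))"
  \<comment> \<open>Adding the two relations cancels \<open>gen (GT 0)\<close> and doubles
    \<open>gen (GG 0)\<close>; the products of \<open>\<W>\<^sub>0\<close> and
    \<open>\<W>\<^sub>1\<close> combine to twice a q-commutator.\<close>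
  have "Delta_free q \<rho> 0 - scal (2 * \<delta> 0)
      + (scal (q + inverse q) * comm (gen (WM 0)) (gen (WP 0)) - (gen (GT 0) - gen (GG 0))) \<in> K"
    by (intro add Delta_rel W0_WP)
  also have "Delta_free q \<rho> 0 - scal (2 * \<delta> 0)
      + (scal (q + inverse q) * comm (gen (WM 0)) (gen (WP 0)) - (gen (GT 0) - gen (GG 0)))
      = scal 2 * ?r"
    using nz by (simp add: Delta_free_0 comm_def qcomm_def scal_2 scal_simps algebra_simps
        scal_commute[of "scal (\<delta> 0)" 2])
  finally have "scal (1 / 2) * (scal 2 * ?r) \<in> K"
    by (rule lmult)
  then show ?thesis
    using nz by (simp add: scal_mult_left scal_simps(2))
qed

lemma q_Dolan_Grady_W0:
  "comm (gen (WM 0)) (qcomm scal (inverse q) (gen (WM 0)) (qcomm scal q (gen (WM 0)) (gen (WP 0))))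
    - scal \<rho> * comm (gen (WM 0)) (gen (WP 0)) \<in> K" (is "?T \<in> K")
proof -
  let ?A = "gen (WM 0)" and ?B = "gen (WP 0)" and ?C = "gen (WM 1)" and ?G = "gen (GG 0)"
  \<comment> \<open>In this combination \<open>?G\<close> and \<open>?C\<close> cancel, and
    \<open>\<delta>\<close> contributes a multiple of \<open>?A\<close>, which commutes with
    \<open>?A\<close>. The rest is \<open>?T\<close>, because exchanging the arguments of a
    q-commutator inverts \<open>q\<close> up to sign and the two q-brackets with \<open>?A\<close>
    commute.\<close>
  have "comm ?A (qcomm scal q ?A (?G - scal (\<delta> 0) - qcomm scal q ?B ?A))
      - comm ?A (qcomm scal q ?A ?G - scal \<rho> * (?C - ?B)) - scal \<rho> * comm ?A ?C \<in> K"
    using aq_rels_W0_GG[of q 0 \<rho>]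
    by (intro diff comm_closed qcomm_closed GG_0 lmult aq_rel aq_rels_WM_WM) simp
  also have "comm ?A (qcomm scal q ?A (?G - scal (\<delta> 0) - qcomm scal q ?B ?A))
      - comm ?A (qcomm scal q ?A ?G - scal \<rho> * (?C - ?B)) - scal \<rho> * comm ?A ?C = ?T"
    by (simp add: comm_def qcomm_def algebra_simps gen_scal scal_mult_left
        flip: scal_simps(6))
  finally show ?thesis .
qed

lemma q_Dolan_Grady_W1:
  "comm (gen (WP 0)) (qcomm scal (inverse q) (gen (WP 0)) (qcomm scal q (gen (WP 0)) (gen (WM 0))))
    - scal \<rho> * comm (gen (WP 0)) (gen (WM 0)) \<in> K" (is "?T \<in> K")
proof -
  let ?A = "gen (WM 0)" and ?B = "gen (WP 0)" and ?D = "gen (WP 1)" and ?G = "gen (GG 0)"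
  have "comm ?B (qcomm scal q (?G - scal (\<delta> 0) - qcomm scal q ?B ?A) ?B)
      - comm ?B (qcomm scal q ?G ?B - scal \<rho> * (?D - ?A)) - scal \<rho> * comm ?B ?D \<in> K"
    using aq_rels_GG_W1[of q 0 \<rho>]
    by (intro diff comm_closed qcomm_closed GG_0 lmult aq_rel aq_rels_WP_WP) simp
  also have "comm ?B (qcomm scal q (?G - scal (\<delta> 0) - qcomm scal q ?B ?A) ?B)
      - comm ?B (qcomm scal q ?G ?B - scal \<rho> * (?D - ?A)) - scal \<rho> * comm ?B ?D = ?T"
    by (simp add: comm_def qcomm_def algebra_simps gen_scal scal_mult_left
        flip: scal_simps(6))
  finally show ?thesis .
qed

section \<open>The map lifted to free algebras, and its surjectivity modulo \<open>K\<close>\<close>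

definition sub :: "(oq_gen list \<Rightarrow>\<^sub>0 'k) \<Rightarrow> aq_gen list \<Rightarrow>\<^sub>0 'k" where
  "sub = subst (\<lambda>g. case g of GenA \<Rightarrow> gen (WM 0) | GenAstar \<Rightarrow> gen (WP 0))"

lemma sub_simps:
  "sub (x + y) = sub x + sub y" "sub (x - y) = sub x - sub y" "sub (x * y) = sub x * sub y"
  "sub (scal c) = scal c" "sub (gen GenA) = gen (WM 0)" "sub (gen GenAstar) = gen (WP 0)"
  by (simp_all add: sub_def subst_add subst_diff subst_mult subst_scal subst_gen)

lemma sub_oq_rels:
  assumes "r \<in> oq_rels q \<rho>"
  shows "sub r \<in> K"
proof -
  have [simp]: "sub (comm x y) = comm (sub x) (sub y)"
    "sub (qcomm scal c x y) = qcomm scal c (sub x) (sub y)" for c x y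
    by (simp_all add: comm_def qcomm_def sub_simps)
  show ?thesis
    using assms q_Dolan_Grady_W0 q_Dolan_Grady_W1
    unfolding oq_rels_def Let_def by (auto simp: sub_simps)
qed

text \<open>Membership of the class of \<open>x\<close> in the subalgebra generated by
  \<open>\<W>\<^sub>0\<close> and \<open>\<W>\<^sub>1\<close>.\<close>

definition reach :: "(aq_gen list \<Rightarrow>\<^sub>0 'k) \<Rightarrow> bool" where
  "reach x \<longleftrightarrow> (\<exists>y. x - sub y \<in> K)"

lemma reach_add: "reach x \<Longrightarrow> reach y \<Longrightarrow> reach (x + y)"
proof (unfold reach_def, elim exE)
  fix a b assume "x - sub a \<in> K" "y - sub b \<in> K"
  then have "x - sub a + (y - sub b) \<in> K"
    by (rule add)
  then have "x + y - sub (a + b) \<in> K"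
    by (simp add: sub_simps algebra_simps)
  then show "\<exists>c. x + y - sub c \<in> K" ..
qed

lemma reach_mult: "reach x \<Longrightarrow> reach y \<Longrightarrow> reach (x * y)"
proof (unfold reach_def, elim exE)
  fix a b assume "x - sub a \<in> K" "y - sub b \<in> K"
  then have "(x - sub a) * y + sub a * (y - sub b) \<in> K"
    by (intro add lmult rmult)
  then have "x * y - sub (a * b) \<in> K"
    by (simp add: sub_simps algebra_simps)
  then show "\<exists>c. x * y - sub c \<in> K" ..
qed

lemma reach_scal: "reach (scal c)"
  unfolding reach_def using zero by (intro exI[of _ "scal c"]) (simp add: sub_simps)

lemma reach_diff:
  assumes "reach x" "reach y"
  shows "reach (x - y)"
proof -
  have "reach (x + scal (- 1) * y)"
    by (intro reach_add reach_mult reach_scal assms)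
  then show ?thesis
    by (simp add: scal_simps)
qed

lemma reach_sum: "(\<And>i. i \<in> I \<Longrightarrow> reach (f i)) \<Longrightarrow> reach (sum f I)"
  \<comment> \<open>Empty sums, and by convention sums over infinite sets, equal 0, which is
    \<open>scal 0\<close>.\<close>
  using reach_scal[of 0] by (induction I rule: infinite_finite_induct) (auto simp: scal_simps reach_add)

lemma reach_cong:
  assumes "x - y \<in> K" "reach x"
  shows "reach y"
proof -
  obtain z where "x - sub z \<in> K"
    using assms(2) by (auto simp: reach_def)
  from diff[OF this assms(1)] show ?thesis
    by (auto simp: reach_def)
qed

lemma reach_comm: "reach x \<Longrightarrow> reach y \<Longrightarrow> reach (comm x y)"
  and reach_qcomm: "reach x \<Longrightarrow> reach y \<Longrightarrow> reach (qcomm scal c x y)"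
  unfolding comm_def qcomm_def by (intro reach_diff reach_mult reach_scal; assumption)+

lemma reach_bbG:
  assumes W: "\<And>i. i \<le> k \<Longrightarrow> reach (gen (WM i)) \<and> reach (gen (WP i))"
    and G: "\<And>i. i < k \<Longrightarrow> reach (gen (GG i)) \<and> reach (gen (GT i))"
  shows "reach (bbG k)"
proof -
  define D where "D = (\<Sum>l<k div 2. scal (d_coeff q k l) * bbG (2 * (l + 1) - kbar k - 1))"
  define F where "F = (\<Sum>l\<le>k div 2. \<Sum>(i, j)\<in>{(i, j). i + j = 2 * l + 1 - kbar k}.
      scal (f_coeff q k i j) * bbW q i j)"
  define E where "E = (\<Sum>l<k div 2 + 1 - kbar k. \<Sum>(i, j)\<in>{(i, j). i + j = 2 * l + kbar k}.
      scal (e_coeff q k i j) * bbF q \<rho> i j)"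
  \<comment> \<open>For either parity of \<open>k\<close> the index of \<open>bbG\<close> is less
    than \<open>k\<close>.\<close>
  have "reach D"
    unfolding D_def bbG_def
    by (intro reach_sum reach_mult reach_scal reach_add conjunct1[OF G] conjunct2[OF G])
      (auto simp: kbar_def split: if_splits elim!: oddE)
  \<comment> \<open>Here the indices sum to at most \<open>k\<close>, so \<open>\<W>\<close> of the
    current level may occur.\<close>
  moreover have "reach (scal c * bbW q i j)" if "i \<le> k" "j \<le> k" for c i j
    unfolding bbW_def using W[OF that(1)] W[OF that(2)]
    by (intro reach_add reach_mult reach_scal) auto
  then have "reach F"
    unfolding F_def
    by (intro reach_sum) (auto simp: kbar_def split: if_splits elim!: oddE evenE)
  \<comment> \<open>Here they sum to at most \<open>k - 1\<close>, so every \<open>\<G>\<close> that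
    occurs is an earlier one.\<close>
  moreover have "reach (scal c * bbF q \<rho> i j)" if "i < k" "j < k" for c i j
    unfolding bbF_def using W[of i] W[of j] G[of i] G[of j] that
    by (intro reach_add reach_mult reach_scal) auto
  then have "reach E"
    unfolding E_def
    by (intro reach_sum) (auto simp: kbar_def split: if_splits elim!: oddE evenE)
  moreover have "scal (2 * \<delta> k) - Delta_free q \<rho> k \<in> K"
    using diff[OF zero Delta_rel] by simp
  then have "reach (Delta_free q \<rho> k)"
    by (rule reach_cong) (rule reach_scal)
  ultimately have "reach (Delta_free q \<rho> k - D - F - E)"
    by (intro reach_diff)
  then show ?thesis
    by (simp add: Delta_free_def D_def F_def E_def)
qed

lemma reach_G:
  assumes W: "reach (gen (WM 0))" "reach (gen (WP k))" and G: "reach (bbG k)"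
  shows "reach (gen (GG k)) \<and> reach (gen (GT k))"
proof -
  have difference: "reach (gen (GT k) - gen (GG k))"
    using W0_WP by (rule reach_cong) (intro reach_mult reach_scal reach_comm W)
  have half: "scal (1 / 2) * (x + x) = x" for x :: "aq_gen list \<Rightarrow>\<^sub>0 'k"
  proof -
    have "scal (1 / 2) * (x + x) = scal (1 / 2 + 1 / 2) * x"
      by (simp only: scal_simps distrib_left distrib_right)
    also have "1 / 2 + 1 / 2 = (1::'k)"
      using nz(1) by (simp add: field_simps)
    finally show ?thesis
      by (simp add: scal_simps)
  qed
  have "reach (scal (1 / 2) * (bbG k - (gen (GT k) - gen (GG k))))"
    "reach (scal (1 / 2) * (bbG k + (gen (GT k) - gen (GG k))))"
    by (intro reach_mult reach_scal reach_diff reach_add difference G)+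
  moreover have "bbG k - (gen (GT k) - gen (GG k)) = gen (GG k) + (gen (GG k) :: _ \<Rightarrow>\<^sub>0 'k)"
    "bbG k + (gen (GT k) - gen (GG k)) = gen (GT k) + (gen (GT k) :: _ \<Rightarrow>\<^sub>0 'k)"
    by (simp_all add: bbG_def)
  ultimately show ?thesis
    by (simp add: half)
qed

lemma reach_solve:
  assumes "z - scal \<rho> * (x - y) \<in> K" "reach z" "reach y"
  shows "reach x"
proof -
  have "scal (1 / \<rho>) * (z - scal \<rho> * (x - y)) \<in> K"
    using assms(1) by (rule lmult)
  also have "scal (1 / \<rho>) * (z - scal \<rho> * (x - y)) = scal (1 / \<rho>) * z + y - x"
    using nz by (simp add: right_diff_distrib[of "scal _"] scal_mult_left scal_simps(2))
  finally show ?thesis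
    by (rule reach_cong) (intro reach_add reach_mult reach_scal assms)
qed

text \<open>The bounds are staggered because level \<open>k\<close> of \<open>\<W>\<close> yields
  level \<open>k\<close> of \<open>\<G>\<close>, which in turn yields level \<open>k + 1\<close> of
  \<open>\<W>\<close>.\<close>

lemma reach_gens:
  "(\<forall>i\<le>k. reach (gen (WM i)) \<and> reach (gen (WP i))) \<and>
   (\<forall>i<k. reach (gen (GG i)) \<and> reach (gen (GT i)))"
proof (induction k)
  case 0
  have "reach (sub y)" for y
    unfolding reach_def using zero by (intro exI[of _ y]) simp
  from this[of "gen GenA"] this[of "gen GenAstar"] show ?case
    by (simp add: sub_simps)
next
  case (Suc k)
  then have "reach (bbG k)"
    by (intro reach_bbG) auto
  with Suc have G: "reach (gen (GG k)) \<and> reach (gen (GT k))"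
    by (intro reach_G) auto
  have "reach (gen (WM (k + 1)))"
    using aq_rel[OF aq_rels_W0_GG] by (rule reach_solve) (use Suc G in \<open>auto intro: reach_qcomm\<close>)
  moreover have "reach (gen (WP (k + 1)))"
    using aq_rel[OF aq_rels_GG_W1] by (rule reach_solve) (use Suc G in \<open>auto intro: reach_qcomm\<close>)
  ultimately show ?case
    using Suc G by (simp add: le_Suc_eq less_Suc_eq)
qed

lemma reach_all: "reach x"
proof (induction x rule: free_algebra_induct)
  case (gen g)
  show ?case
    using reach_gens by (cases g) blast+
qed (auto intro: reach_scal reach_add reach_mult)

end

section \<open>The surjection\<close>

text \<open>The composite of both projections; working with its kernel avoids cosets of
  cosets.\<close>

definition Aq_delta_class ::
    "'k::field \<Rightarrow> 'k \<Rightarrow> (nat \<Rightarrow> 'k) \<Rightarrow> (aq_gen list \<Rightarrow>\<^sub>0 'k) \<Rightarrow> (aq_gen list \<Rightarrow>\<^sub>0 'k) set set" where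
  "Aq_delta_class q \<rho> \<delta> x =
    Aq_delta_ideal q \<rho> \<delta> +>\<^bsub>Aq q \<rho>\<^esub> presented_class (aq_rels q \<rho>) x"

lemma scalar_ring_Aq_delta: "scalar_ring (Aq_delta q \<rho> \<delta>)"
  and Aq_delta_class_alg_hom: "Aq_delta_class q \<rho> \<delta> \<in> alg_hom free_algebra (Aq_delta q \<rho> \<delta>)"
  and carrier_Aq_delta: "carrier (Aq_delta q \<rho> \<delta>) = range (Aq_delta_class q \<rho> \<delta>)"
  and Aq_delta_class_aq_rel:
    "r \<in> aq_rels q \<rho> \<Longrightarrow> Aq_delta_class q \<rho> \<delta> r = \<zero>\<^bsub>Aq_delta q \<rho> \<delta>\<^esub>"
  and Aq_delta_class_Delta:
    "Aq_delta_class q \<rho> \<delta> (Delta_free q \<rho> k - scal (2 * \<delta> k)) = \<zero>\<^bsub>Aq_delta q \<rho> \<delta>\<^esub>"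
proof -
  let ?c = "presented_class (aq_rels q \<rho>)"
  interpret A: scalar_ring "Aq q \<rho>"
    unfolding Aq_def by (rule scalar_ring_presented_algebra)
  have c: "?c \<in> alg_hom free_algebra (Aq q \<rho>)"
    unfolding Aq_def by (rule presented_class_alg_hom)
  have c_ring: "?c \<in> ring_hom free_algebra (Aq q \<rho>)"
    using c by (simp add: alg_hom_def)
  have c_closed: "?c x \<in> carrier (Aq q \<rho>)" for x
    using ring_hom_closed[OF c_ring, of x] by simp
  have c_scal: "?c (scal a) = a \<odot>\<^bsub>Aq q \<rho>\<^esub> \<one>\<^bsub>Aq q \<rho>\<^esub>" for a
  proof -
    have "?c (a \<odot>\<^bsub>free_algebra\<^esub> \<one>\<^bsub>free_algebra\<^esub>) = a \<odot>\<^bsub>Aq q \<rho>\<^esub> ?c \<one>\<^bsub>free_algebra\<^esub>"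
      using c by (simp add: alg_hom_def)
    then show ?thesis
      using ring_hom_one[OF c_ring] by (simp add: free_algebra_def)
  qed
  define R where "R = range (\<lambda>k.
      Delta q \<rho> k \<ominus>\<^bsub>Aq q \<rho>\<^esub> ((2 * \<delta> k) \<odot>\<^bsub>Aq q \<rho>\<^esub> \<one>\<^bsub>Aq q \<rho>\<^esub>))"
  \<comment> \<open>The generators of the second ideal are images of elements of the free algebra,
    so both sets of relations can be handled there.\<close>
  have Delta: "Delta q \<rho> k \<ominus>\<^bsub>Aq q \<rho>\<^esub> ((2 * \<delta> k) \<odot>\<^bsub>Aq q \<rho>\<^esub> \<one>\<^bsub>Aq q \<rho>\<^esub>)
      = ?c (Delta_free q \<rho> k - scal (2 * \<delta> k))" for k
  proof -
    let ?x = "?c (Delta_free q \<rho> k - scal (2 * \<delta> k))"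
    have "Delta q \<rho> k = ?x \<oplus>\<^bsub>Aq q \<rho>\<^esub> (2 * \<delta> k) \<odot>\<^bsub>Aq q \<rho>\<^esub> \<one>\<^bsub>Aq q \<rho>\<^esub>"
      using ring_hom_add[OF c_ring, of "Delta_free q \<rho> k - scal (2 * \<delta> k)" "scal (2 * \<delta> k)"]
      by (simp add: c_scal Delta_def) (simp add: free_algebra_def)
    then show ?thesis
      using c_closed[of "Delta_free q \<rho> k - scal (2 * \<delta> k)"]
      by (simp add: A.minus_eq A.a_assoc A.r_neg)
  qed
  have R: "R \<subseteq> carrier (Aq q \<rho>)"
    using Delta c_closed by (auto simp: R_def)
  have J: "ideal (Aq_delta_ideal q \<rho> \<delta>) (Aq q \<rho>)"
    using A.genideal_ideal[OF R] by (simp add: Aq_delta_ideal_def R_def)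
  show "scalar_ring (Aq_delta q \<rho> \<delta>)"
    unfolding Aq_delta_def by (rule A.scalar_ring_quot_alg[OF J])
  show hom: "Aq_delta_class q \<rho> \<delta> \<in> alg_hom free_algebra (Aq_delta q \<rho> \<delta>)"
    using alg_hom_comp[OF c A.coset_alg_hom[OF J]]
    unfolding Aq_delta_def Aq_delta_class_def by simp
  show "carrier (Aq_delta q \<rho> \<delta>) = range (Aq_delta_class q \<rho> \<delta>)"
    unfolding Aq_delta_def Aq_delta_class_def carrier_quot_alg
    by (simp add: Aq_def carrier_presented_algebra image_image)
  show "Aq_delta_class q \<rho> \<delta> r = \<zero>\<^bsub>Aq_delta q \<rho> \<delta>\<^esub>" if "r \<in> aq_rels q \<rho>"
  proof -
    have "?c r = \<zero>\<^bsub>Aq q \<rho>\<^esub>"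
      using presented_class_rel[OF that] by (simp add: Aq_def)
    then have "?c r \<in> Aq_delta_ideal q \<rho> \<delta>"
      using additive_subgroup.zero_closed[OF ideal.axioms(1)[OF J]] by simp
    then show ?thesis
      unfolding Aq_delta_def Aq_delta_class_def by (rule A.coset_eq_zero[OF J])
  qed
  have "?c (Delta_free q \<rho> k - scal (2 * \<delta> k)) \<in> R"
    unfolding R_def Delta by blast
  then have "?c (Delta_free q \<rho> k - scal (2 * \<delta> k)) \<in> Aq_delta_ideal q \<rho> \<delta>"
    using A.genideal_self[OF R] by (auto simp: Aq_delta_ideal_def R_def)
  then show "Aq_delta_class q \<rho> \<delta> (Delta_free q \<rho> k - scal (2 * \<delta> k)) = \<zero>\<^bsub>Aq_delta q \<rho> \<delta>\<^esub>"
    unfolding Aq_delta_def Aq_delta_class_def by (rule A.coset_eq_zero[OF J])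
qed

theorem proposition4p1:
  fixes q \<rho> :: "'k::field" and \<delta> :: "nat \<Rightarrow> 'k"
  assumes "CHAR('k) \<noteq> 2"
    and "q \<noteq> 0"
    and "\<forall>n::nat. n > 0 \<longrightarrow> q ^ n \<noteq> 1"
    and "\<rho> \<noteq> 0"
  shows "\<exists>\<Psi> \<in> alg_hom (Oq q \<rho>) (Aq_delta q \<rho> \<delta>).
    \<Psi> (Oq_gen q \<rho> GenA) = Aq_delta_gen q \<rho> \<delta> (WM 0) \<and>
    \<Psi> (Oq_gen q \<rho> GenAstar) = Aq_delta_gen q \<rho> \<delta> (WP 0) \<and>
    \<Psi> ` carrier (Oq q \<rho>) = carrier (Aq_delta q \<rho> \<delta>) \<and>
    (\<forall>\<Phi> \<in> alg_hom (Oq q \<rho>) (Aq_delta q \<rho> \<delta>).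
       \<Phi> (Oq_gen q \<rho> GenA) = Aq_delta_gen q \<rho> \<delta> (WM 0) \<and>
       \<Phi> (Oq_gen q \<rho> GenAstar) = Aq_delta_gen q \<rho> \<delta> (WP 0) \<longrightarrow>
       (\<forall>x \<in> carrier (Oq q \<rho>). \<Phi> x = \<Psi> x))"
proof -
  let ?B = "Aq_delta q \<rho> \<delta>" and ?\<pi> = "Aq_delta_class q \<rho> \<delta>"
  let ?c = "presented_class (oq_rels q \<rho>)"
  define K where "K = {x. ?\<pi> x = \<zero>\<^bsub>?B\<^esub>}"
  \<comment> \<open>If 2 vanished, the characteristic would divide 2 and hence be 1, which is
    impossible in a field.\<close>
  have two: "(2::'k) \<noteq> 0"
  proof
    assume "(2::'k) = 0"
    then have "CHAR('k) dvd 2"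
      using of_nat_eq_0_iff_char_dvd[where 'a='k, of 2] by simp
    then have "CHAR('k) \<le> 2" and "CHAR('k) \<noteq> 0"
      using dvd_imp_le[of "CHAR('k)" 2] by (simp, metis dvd_0_left zero_neq_numeral)
    with assms(1) have "CHAR('k) = 1"
      by linarith
    then show False
      using of_nat_eq_0_iff_char_dvd[where 'a='k, of 1] by simp
  qed
  \<comment> \<open>Otherwise \<open>q\<close> would be a fourth root of unity.\<close>
  have p: "q + inverse q \<noteq> 0"
  proof
    assume "q + inverse q = 0"
    then have "q ^ 2 = - 1"
      using assms(2) by (simp add: power2_eq_square field_simps add_eq_0_iff)
    then have "q ^ 4 = 1"
      using power_mult[of q 2 2] by simp
    then show False
      using assms(3) by simp
  qed
  interpret two_sided_ideal K
    unfolding K_def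
    using scalar_ring_Aq_delta Aq_delta_class_alg_hom by (rule two_sided_ideal_kernel)
  interpret Aq_delta_kernel K q \<rho> \<delta>
    using two p assms(2,4) Aq_delta_class_aq_rel Aq_delta_class_Delta
    by unfold_locales (simp_all add: K_def)
  have sub_hom: "(\<lambda>x. ?\<pi> (sub x)) \<in> alg_hom free_algebra ?B"
    unfolding sub_def by (rule alg_hom_comp[OF subst_alg_hom Aq_delta_class_alg_hom])
  obtain \<Psi> where \<Psi>: "\<Psi> \<in> alg_hom (Oq q \<rho>) ?B" and \<Psi>_class: "\<And>x. \<Psi> (?c x) = ?\<pi> (sub x)"
  proof (rule alg_hom_presented_algebra[OF scalar_ring_Aq_delta sub_hom, of "oq_rels q \<rho>"])
    show "?\<pi> (sub r) = \<zero>\<^bsub>?B\<^esub>" if "r \<in> oq_rels q \<rho>" for r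
      using sub_oq_rels[OF that] by (simp add: K_def)
  qed (simp add: Oq_def)
  have gens: "Oq_gen q \<rho> g = ?c (gen g)" "Aq_delta_gen q \<rho> \<delta> h = ?\<pi> (gen h)" for g h
    by (simp_all add: Oq_gen_def Aq_delta_gen_def Aq_delta_class_def)
  have carrier: "carrier (Oq q \<rho>) = range ?c"
    by (simp add: Oq_def carrier_presented_algebra)
  have "?\<pi> x \<in> range (\<lambda>x. ?\<pi> (sub x))" for x
  proof -
    obtain y where "x - sub y \<in> K"
      using reach_all[of x] unfolding reach_def by blast
    then have "?\<pi> x = ?\<pi> (sub y)"
      using alg_hom_free_algebra_eq_iff[OF scalar_ring_Aq_delta Aq_delta_class_alg_hom]
      unfolding K_def by blast
    then show ?thesis
      by blast
  qed
  then have surj: "\<Psi> ` carrier (Oq q \<rho>) = carrier ?B"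
    by (auto simp: carrier carrier_Aq_delta image_image \<Psi>_class)
  \<comment> \<open>Both maps are composed with the projection \<open>?c\<close>, and homomorphisms
    on the free algebra are determined by the generators.\<close>
  have unique: "\<Phi> (?c x) = \<Psi> (?c x)"
    if \<Phi>: "\<Phi> \<in> alg_hom (Oq q \<rho>) ?B" and A: "\<Phi> (?c (gen GenA)) = ?\<pi> (gen (WM 0))"
      and Astar: "\<Phi> (?c (gen GenAstar)) = ?\<pi> (gen (WP 0))" for \<Phi> x
  proof (rule alg_hom_free_algebra_eqI)
    have c: "?c \<in> alg_hom free_algebra (Oq q \<rho>)"
      unfolding Oq_def by (rule presented_class_alg_hom)
    show "(\<lambda>x. \<Phi> (?c x)) \<in> alg_hom free_algebra ?B" "(\<lambda>x. \<Psi> (?c x)) \<in> alg_hom free_algebra ?B"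
      by (rule alg_hom_comp[OF c \<Phi>], rule alg_hom_comp[OF c \<Psi>])
    show "\<Phi> (?c (gen g)) = \<Psi> (?c (gen g))" for g
      by (cases g) (simp_all add: A Astar \<Psi>_class sub_simps)
  qed
  show ?thesis
    using \<Psi> surj unique
    by (intro bexI[of _ \<Psi>]) (auto simp: gens carrier \<Psi>_class sub_simps)
qed

end
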